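(* Let $(c_n)_{n\ge0}$ and $(d_n)_{n\ge0}$ be sequences of complex numbers satisfying $d_n=\sum_{i=0}^n\binom ni c_i$ for all $n\ge0$. Then for all complex numbers $a,b$ and all nonnegative integers $n$, \begin{gather*} \sum_{i=0}^n\binom ai\binom b{n-i}d_i=\sum_{j=0}^n\binom aj\binom{a+b-j}{n-j}c_j,\\ \sum_{i=0}^n\binom ai\binom{2a-2i}{n-i}(-2)^id_i=\sum_{j=0}^{\lfloor n/2\rfloor}\binom a{n-j}\binom{n-j}j(-2)^{n-2j}c_{n-2j},\\ \sum_{i=0}^n\binom ai\binom{2a-2i}{n-i}(-4)^id_i=(-1)^n\sum_{j=0}^n\binom aj\binom{2a-2j}{n-j}4^jc_j. \end{gather*}
   Context: For complex $a$ and integer $k\ge0$, $\binom ak=a(a-1)\cdots(a-k+1)/k!$. *)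

theory Defs
  imports Complex_Main
begin

end

theory Submission
  imports Defs "HOL-Computational_Algebra.Computational_Algebra"
begin

text \<open>
  Substituting the definition of d and using
  $\binom{a}{i}\binom{i}{j} = \binom{a}{j}\binom{a-j}{i-j}$, the coefficient of each $c_j$ becomes a
  convolution. The first is Vandermonde's. The other two are
  $\sum_k \binom{A}{k}\binom{2A-2k}{m-k}x^k = [t^m]\,((1+t)^2+xt)^A$, where the base is
  $1+t^2$ for $x=-2$ and $(1-t)^2$ for $x=-4$. As both sides are polynomial in $A$,
  it suffices to compare coefficients for natural $A$.
\<close>

section \<open>Polynomial functions and their determination by values at natural numbers\<close>

definition polynomial_fun :: "('a::comm_ring_1 \<Rightarrow> 'a) \<Rightarrow> bool" where
  "polynomial_fun f \<longleftrightarrow> (\<exists>p. \<forall>x. f x = poly p x)"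

lemma polynomial_fun_const: "polynomial_fun (\<lambda>x. c)"
  unfolding polynomial_fun_def by (rule exI[of _ "[:c:]"]) simp

lemma polynomial_fun_id: "polynomial_fun (\<lambda>x. x)"
  unfolding polynomial_fun_def by (rule exI[of _ "[:0, 1:]"]) simp

lemma polynomial_fun_diff:
  "polynomial_fun f \<Longrightarrow> polynomial_fun g \<Longrightarrow> polynomial_fun (\<lambda>x. f x - g x)"
  unfolding polynomial_fun_def by (metis poly_diff)

lemma polynomial_fun_mult:
  "polynomial_fun f \<Longrightarrow> polynomial_fun g \<Longrightarrow> polynomial_fun (\<lambda>x. f x * g x)"
  unfolding polynomial_fun_def by (metis poly_mult)

lemma polynomial_fun_sum:
  assumes "\<And>i. i \<in> S \<Longrightarrow> polynomial_fun (f i)"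
  shows "polynomial_fun (\<lambda>x. \<Sum>i\<in>S. f i x)"
proof -
  from assms obtain p where "\<And>i x. i \<in> S \<Longrightarrow> f i x = poly (p i) x"
    unfolding polynomial_fun_def by metis
  then show ?thesis
    unfolding polynomial_fun_def by (intro exI[of _ "\<Sum>i\<in>S. p i"]) (simp add: poly_sum)
qed

lemma polynomial_fun_prod:
  assumes "\<And>i. i \<in> S \<Longrightarrow> polynomial_fun (f i)"
  shows "polynomial_fun (\<lambda>x. \<Prod>i\<in>S. f i x)"
proof -
  from assms obtain p where "\<And>i x. i \<in> S \<Longrightarrow> f i x = poly (p i) x"
    unfolding polynomial_fun_def by metis
  then show ?thesis
    unfolding polynomial_fun_def by (intro exI[of _ "\<Prod>i\<in>S. p i"]) (simp add: poly_prod)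
qed

text \<open>For fixed \<open>k\<close>, the generalized binomial coefficient is a product of
  \<open>k\<close> factors linear in its upper argument, times the constant
  \<open>inverse (fact k)\<close>.\<close>

lemma polynomial_fun_gchoose:
  fixes f :: "'a::field_char_0 \<Rightarrow> 'a"
  assumes "polynomial_fun f"
  shows "polynomial_fun (\<lambda>x. f x gchoose k)"
  unfolding gbinomial_prod_rev divide_inverse
  by (intro polynomial_fun_mult polynomial_fun_prod polynomial_fun_diff polynomial_fun_const assms)

text \<open>In characteristic 0 the naturals form an infinite subset of the field, and a nonzero
  polynomial has only finitely many roots, so the difference of the two representing polynomials is
  zero.\<close>

lemma polynomial_fun_eqI:
  fixes f g :: "'a::field_char_0 \<Rightarrow> 'a"
  assumes "polynomial_fun f" "polynomial_fun g" "\<And>n. f (of_nat n) = g (of_nat n)"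
  shows "f x = g x"
proof -
  from assms(1,2) obtain p q where p: "\<And>x. f x = poly p x" and q: "\<And>x. g x = poly q x"
    unfolding polynomial_fun_def by metis
  have "p - q = 0"
  proof (rule ccontr)
    assume "p - q \<noteq> 0"
    then have "finite {x. poly (p - q) x = 0}"
      by (rule poly_roots_finite)
    moreover have "range of_nat \<subseteq> {x. poly (p - q) x = 0}"
      using assms(3) p q by auto
    ultimately have "finite (range (of_nat :: nat \<Rightarrow> 'a))"
      by (rule rev_finite_subset)
    then show False
      using range_inj_infinite[OF inj_of_nat] by blast
  qed
  then show ?thesis using p q by simp
qed

section \<open>Coefficients of powers of formal power series\<close>

lemma fps_nth_one_plus_monom_power:
  fixes c :: "'a::comm_ring_1"
  assumes "p > 0"
  shows "((1 + fps_const c * fps_X ^ p) ^ N) $ m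
    = (if p dvd m then of_nat (N choose (m div p)) * c ^ (m div p) else 0)"
proof -
  have "(1 + fps_const c * fps_X ^ p) ^ N
      = (\<Sum>k\<le>N. of_nat (N choose k) * (fps_const c * fps_X ^ p) ^ k)"
    by (subst add.commute, subst binomial_ring) simp
  also have "\<dots> = (\<Sum>k\<le>N. fps_const (of_nat (N choose k) * c ^ k) * fps_X ^ (p * k))"
    by (simp add: power_mult_distrib mult_ac flip: power_mult fps_of_nat fps_const_power fps_const_mult)
  finally have "((1 + fps_const c * fps_X ^ p) ^ N) $ m
      = (\<Sum>k\<le>N. if m = p * k then of_nat (N choose k) * c ^ k else 0)"
    by (simp add: fps_sum_nth fps_X_power_nth if_distrib cong: if_cong)
  \<comment> \<open>Since \<open>p > 0\<close>, at most one \<open>k\<close> satisfies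
    \<open>m = p * k\<close>. If that \<open>k\<close> exceeds \<open>N\<close>, no term survives,
    which agrees with \<open>N choose k = 0\<close>.\<close>
  also have "\<dots> = (\<Sum>k\<le>N. if p dvd m \<and> k = m div p then of_nat (N choose k) * c ^ k else 0)"
    using assms by (intro sum.cong) auto
  also have "\<dots> = (if p dvd m then of_nat (N choose (m div p)) * c ^ (m div p) else 0)"
    by (auto simp: binomial_eq_0)
  finally show ?thesis .
qed

text \<open>Binomial expansion in the summands \<open>fps_const x * fps_X\<close> and
  \<open>(1 + fps_X) ^ 2\<close>: the factor \<open>fps_X ^ k\<close> shifts the coefficient index
  to \<open>m - k\<close>, to be read off from \<open>(1 + fps_X) ^ (2 * (N - k))\<close>.\<close>

lemma fps_nth_trinomial_power:
  fixes x :: "'a::field_char_0"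
  shows "(((1 + fps_X) ^ 2 + fps_const x * fps_X) ^ N) $ m
    = (\<Sum>k\<le>m. (of_nat N gchoose k) * ((2 * of_nat N - 2 * of_nat k) gchoose (m - k)) * x ^ k)"
proof -
  have nth: "((1 + fps_X) ^ (2 * (N - k)) :: 'a fps) $ j = (2 * of_nat N - 2 * of_nat k) gchoose j"
    if "k \<le> N" for k j
  proof -
    have "((1 + fps_X) ^ (2 * (N - k)) :: 'a fps) $ j = of_nat (2 * (N - k)) gchoose j"
      by (simp only: fps_binomial_of_nat[symmetric] fps_binomial_nth)
    then show ?thesis using that by (simp add: of_nat_diff algebra_simps)
  qed
  have "((1 + fps_X) ^ 2 + fps_const x * fps_X) ^ N
      = (\<Sum>k\<le>N. of_nat (N choose k) * (fps_const x * fps_X) ^ k * ((1 + fps_X) ^ 2) ^ (N - k))"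
    by (subst add.commute, subst binomial_ring) simp
  also have "\<dots> = (\<Sum>k\<le>N. fps_const (of_nat (N choose k) * x ^ k)
      * (fps_X ^ k * (1 + fps_X) ^ (2 * (N - k))))"
    by (simp add: power_mult_distrib mult_ac flip: power_mult fps_of_nat fps_const_power fps_const_mult)
  finally have "(((1 + fps_X) ^ 2 + fps_const x * fps_X) ^ N) $ m
      = (\<Sum>k\<le>N. of_nat (N choose k) * x ^ k
          * (if m < k then 0 else ((1 + fps_X) ^ (2 * (N - k)) :: 'a fps) $ (m - k)))"
    by (simp only: fps_sum_nth fps_X_power_mult_nth fps_mult_left_const_nth)
  also have "\<dots> = (\<Sum>k\<le>N. of_nat (N choose k) * x ^ k
          * (if m < k then 0 else (2 * of_nat N - 2 * of_nat k) gchoose (m - k)))"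
    by (rule sum.cong[OF refl]) (simp only: nth atMost_iff)
  \<comment> \<open>The range is changed from \<open>{..N}\<close> to \<open>{..m}\<close> through
    the intersection: terms with \<open>k > m\<close> vanish by the shift, those with
    \<open>k > N\<close> because \<open>N choose k = 0\<close>. A bound free of \<open>N\<close> is
    what makes the sum polynomial in \<open>N\<close>.\<close>
  also have "\<dots> = (\<Sum>k\<in>{..N} \<inter> {..m}. (of_nat N gchoose k)
          * ((2 * of_nat N - 2 * of_nat k) gchoose (m - k)) * x ^ k)"
    by (rule sum.mono_neutral_cong_right) (auto simp: binomial_gbinomial)
  also have "\<dots> = (\<Sum>k\<le>m. (of_nat N gchoose k)
          * ((2 * of_nat N - 2 * of_nat k) gchoose (m - k)) * x ^ k)"
    by (rule sum.mono_neutral_left) (auto simp: binomial_gbinomial[symmetric])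
  finally show ?thesis .
qed

text \<open>For natural \<open>A\<close>, both sides are the coefficient at \<open>m\<close> of the
  \<open>A\<close>-th power of the two forms of the base. Both are polynomial in \<open>A\<close>,
  since the condition \<open>p dvd m\<close> does not involve \<open>A\<close>. The parameters cover
  \<open>1 + t^2\<close> (\<open>p = 2\<close>, \<open>c = 1\<close>, \<open>q = 1\<close>) and
  \<open>(1 - t)^2\<close> (\<open>p = 1\<close>, \<open>c = -1\<close>,
  \<open>q = 2\<close>).\<close>

lemma sum_gchoose_trinomial:
  fixes x c A :: "'a::field_char_0"
  assumes "p > 0"
    and base: "(1 + fps_X) ^ 2 + fps_const x * fps_X = (1 + fps_const c * fps_X ^ p) ^ q"
  shows "(\<Sum>k\<le>m. (A gchoose k) * ((2 * A - 2 * of_nat k) gchoose (m - k)) * x ^ k)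
    = (if p dvd m then ((of_nat q * A) gchoose (m div p)) * c ^ (m div p) else 0)"
proof (rule polynomial_fun_eqI[where x = A])
  show "polynomial_fun (\<lambda>A. \<Sum>k\<le>m. (A gchoose k)
      * ((2 * A - 2 * of_nat k) gchoose (m - k)) * x ^ k)"
    by (intro polynomial_fun_sum polynomial_fun_mult polynomial_fun_gchoose polynomial_fun_diff
        polynomial_fun_const polynomial_fun_id)
  show "polynomial_fun (\<lambda>A. if p dvd m then ((of_nat q * A) gchoose (m div p)) * c ^ (m div p) else 0)"
    by (cases "p dvd m")
      (simp_all, intro polynomial_fun_mult polynomial_fun_gchoose
        polynomial_fun_const polynomial_fun_id, rule polynomial_fun_const)
  show "(\<Sum>k\<le>m. (of_nat N gchoose k) * ((2 * of_nat N - 2 * of_nat k) gchoose (m - k)) * x ^ k)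
      = (if p dvd m then ((of_nat q * of_nat N) gchoose (m div p)) * c ^ (m div p) else 0)" for N
    unfolding fps_nth_trinomial_power[symmetric] base power_mult[symmetric]
      fps_nth_one_plus_monom_power[OF \<open>p > 0\<close>]
    by (simp add: binomial_gbinomial)
qed

lemma sum_gchoose_minus_2:
  fixes A :: "'a::field_char_0"
  shows "(\<Sum>k\<le>m. (A gchoose k) * ((2 * A - 2 * of_nat k) gchoose (m - k)) * (-2) ^ k)
    = (if even m then A gchoose (m div 2) else 0)"
proof -
  have base: "(1 + fps_X) ^ 2 + fps_const (-2) * fps_X = (1 + fps_const 1 * fps_X ^ 2 :: 'a fps) ^ 1"
    by (simp add: power2_eq_square algebra_simps numeral_fps_const flip: fps_const_neg)
  show ?thesis
    using sum_gchoose_trinomial[OF _ base, where m = m and A = A] by simp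
qed

lemma sum_gchoose_minus_4:
  fixes A :: "'a::field_char_0"
  shows "(\<Sum>k\<le>m. (A gchoose k) * ((2 * A - 2 * of_nat k) gchoose (m - k)) * (-4) ^ k)
    = (-1) ^ m * ((2 * A) gchoose m)"
proof -
  have base: "(1 + fps_X) ^ 2 + fps_const (-4) * fps_X = (1 + fps_const (-1) * fps_X ^ 1 :: 'a fps) ^ 2"
    by (simp add: power2_eq_square algebra_simps numeral_fps_const flip: fps_const_neg)
  show ?thesis
    using sum_gchoose_trinomial[OF _ base, where m = m and A = A] by (simp add: mult.commute)
qed

section \<open>Weighted sums of the binomial transform\<close>

lemma sum_gchoose_binomial_transform:
  fixes c d w :: "nat \<Rightarrow> 'a::field_char_0"
  assumes d: "\<And>m. d m = (\<Sum>i=0..m. of_nat (m choose i) * c i)"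
  shows "(\<Sum>i=0..n. (a gchoose i) * w i * d i)
    = (\<Sum>j=0..n. (a gchoose j) * (\<Sum>k\<le>n - j. ((a - of_nat j) gchoose k) * w (j + k)) * c j)"
proof -
  have "(\<Sum>i=0..n. (a gchoose i) * w i * d i)
      = (\<Sum>i=0..n. \<Sum>j=0..i. (a gchoose i) * w i * (of_nat (i choose j) * c j))"
    by (simp add: d sum_distrib_left)
  also have "\<dots> = (\<Sum>i=0..n. \<Sum>j | j \<in> {0..n} \<and> j \<le> i.
      (a gchoose i) * w i * (of_nat (i choose j) * c j))"
    by (intro sum.cong refl) auto
  also have "\<dots> = (\<Sum>j=0..n. \<Sum>i | i \<in> {0..n} \<and> j \<le> i.
      (a gchoose i) * w i * (of_nat (i choose j) * c j))"
    by (rule sum.swap_restrict) simp_all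
  also have "\<dots> = (\<Sum>j=0..n. \<Sum>i=j..n. (a gchoose i) * w i * (of_nat (i choose j) * c j))"
    by (intro sum.cong refl) auto
  also have "\<dots> = (\<Sum>j=0..n. (a gchoose j)
      * (\<Sum>k\<le>n - j. ((a - of_nat j) gchoose k) * w (j + k)) * c j)"
  proof (rule sum.cong[OF refl])
    fix j assume "j \<in> {0..n}"
    then have j: "j \<le> n" by simp
    have "(\<Sum>i=j..n. (a gchoose i) * w i * (of_nat (i choose j) * c j))
        = (\<Sum>k\<le>n - j. (a gchoose (j + k)) * w (j + k) * (of_nat ((j + k) choose j) * c j))"
      using j by (intro sum.reindex_bij_witness[of _ "\<lambda>k. j + k" "\<lambda>i. i - j"]) auto
    also have "\<dots> = (\<Sum>k\<le>n - j. (a gchoose j) * (((a - of_nat j) gchoose k) * w (j + k)) * c j)"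
    proof (rule sum.cong[OF refl])
      fix k
      \<comment> \<open>Trinomial revision moves the factor depending only on \<open>j\<close> out
        of the inner sum, leaving a convolution in \<open>k\<close> with upper argument
        \<open>a - j\<close>.\<close>
      have "(a gchoose (j + k)) * of_nat ((j + k) choose j) = (a gchoose j) * ((a - of_nat j) gchoose k)"
        using gbinomial_trinomial_revision[of j "j + k" a] by (simp add: binomial_gbinomial)
      then show "(a gchoose (j + k)) * w (j + k) * (of_nat ((j + k) choose j) * c j)
          = (a gchoose j) * (((a - of_nat j) gchoose k) * w (j + k)) * c j"
        by (metis (no_types, lifting) mult.assoc mult.commute)
    qed
    finally show "(\<Sum>i=j..n. (a gchoose i) * w i * (of_nat (i choose j) * c j))
        = (a gchoose j) * (\<Sum>k\<le>n - j. ((a - of_nat j) gchoose k) * w (j + k)) * c j"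
      by (simp add: sum_distrib_left sum_distrib_right)
  qed
  finally show ?thesis .
qed

text \<open>Writing \<open>2 * a - 2 * (j + k)\<close> as \<open>2 * (a - j) - 2 * k\<close> gives
  the inner sum the shape of \<open>sum_gchoose_trinomial\<close> with \<open>A = a - j\<close> and
  \<open>m = n - j\<close>.\<close>

lemma sum_gchoose_power_binomial_transform:
  fixes c d :: "nat \<Rightarrow> 'a::field_char_0"
  assumes d: "\<And>m. d m = (\<Sum>i=0..m. of_nat (m choose i) * c i)"
  shows "(\<Sum>i=0..n. (a gchoose i) * ((2 * a - 2 * of_nat i) gchoose (n - i)) * x ^ i * d i)
    = (\<Sum>j=0..n. (a gchoose j) * x ^ j * (\<Sum>k\<le>n - j. ((a - of_nat j) gchoose k)
        * ((2 * (a - of_nat j) - 2 * of_nat k) gchoose (n - j - k)) * x ^ k) * c j)"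
  using sum_gchoose_binomial_transform[of d c a
      "\<lambda>i. ((2 * a - 2 * of_nat i) gchoose (n - i)) * x ^ i" n, OF d]
  by (simp add: sum_distrib_left power_add algebra_simps)

theorem theorem7p5:
  fixes c d :: "nat \<Rightarrow> complex" and a b :: complex and n :: nat
  assumes d: "\<And>m. d m = (\<Sum>i=0..m. of_nat (m choose i) * c i)"
  shows "(\<Sum>i=0..n. (a gchoose i) * (b gchoose (n - i)) * d i)
           = (\<Sum>j=0..n. (a gchoose j) * ((a + b - of_nat j) gchoose (n - j)) * c j)
       \<and> (\<Sum>i=0..n. (a gchoose i) * ((2 * a - 2 * of_nat i) gchoose (n - i)) * (-2) ^ i * d i)
           = (\<Sum>j=0..n div 2. (a gchoose (n - j)) * of_nat ((n - j) choose j)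
                * (-2) ^ (n - 2 * j) * c (n - 2 * j))
       \<and> (\<Sum>i=0..n. (a gchoose i) * ((2 * a - 2 * of_nat i) gchoose (n - i)) * (-4) ^ i * d i)
           = (-1) ^ n * (\<Sum>j=0..n. (a gchoose j) * ((2 * a - 2 * of_nat j) gchoose (n - j))
                * 4 ^ j * c j)"
proof (intro conjI)
  show "(\<Sum>i=0..n. (a gchoose i) * (b gchoose (n - i)) * d i)
      = (\<Sum>j=0..n. (a gchoose j) * ((a + b - of_nat j) gchoose (n - j)) * c j)"
    unfolding sum_gchoose_binomial_transform[of d c a "\<lambda>i. b gchoose (n - i)" n, OF d]
  proof (rule sum.cong[OF refl])
    fix j assume "j \<in> {0..n}"
    show "(a gchoose j) * (\<Sum>k\<le>n - j. ((a - of_nat j) gchoose k) * (b gchoose (n - (j + k)))) * c j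
        = (a gchoose j) * ((a + b - of_nat j) gchoose (n - j)) * c j"
      \<comment> \<open>The upper arguments \<open>a - j\<close> and \<open>b\<close> add up to
        \<open>a + b - j\<close>, and \<open>n - (j + k)\<close> is the complementary lower index
        \<open>(n - j) - k\<close>.\<close>
      using gbinomial_Vandermonde[of "a - of_nat j" b "n - j"]
      by (simp add: atMost_atLeast0 add_diff_eq diff_add_eq)
  qed
next
  have "(\<Sum>i=0..n. (a gchoose i) * ((2 * a - 2 * of_nat i) gchoose (n - i)) * (-2) ^ i * d i)
      = (\<Sum>j=0..n. (a gchoose j) * (-2) ^ j
          * (if even (n - j) then (a - of_nat j) gchoose ((n - j) div 2) else 0) * c j)"
    unfolding sum_gchoose_power_binomial_transform[of d c, OF d] sum_gchoose_minus_2 ..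
  also have "\<dots> = (\<Sum>j\<in>{j\<in>{0..n}. even (n - j)}.
      (a gchoose j) * (-2) ^ j * ((a - of_nat j) gchoose ((n - j) div 2)) * c j)"
    by (rule sum.mono_neutral_cong_right) auto
  also have "\<dots> = (\<Sum>j=0..n div 2. (a gchoose (n - 2 * j)) * (-2) ^ (n - 2 * j)
      * ((a - of_nat (n - 2 * j)) gchoose j) * c (n - 2 * j))"
  \<comment> \<open>The new index is half of the even gap \<open>n - j\<close>. Evenness makes the
    halving exact, and \<open>j \<le> n div 2\<close> keeps \<open>n - 2 * j\<close> from being
    truncated, so the two maps are mutually inverse.\<close>
  proof (rule sum.reindex_bij_witness[of _ "\<lambda>j. n - 2 * j" "\<lambda>j. (n - j) div 2"])
    fix j assume "j \<in> {j\<in>{0..n}. even (n - j)}"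
    then show eq: "n - 2 * ((n - j) div 2) = j" by auto
    show "(a gchoose (n - 2 * ((n - j) div 2))) * (-2) ^ (n - 2 * ((n - j) div 2))
          * ((a - of_nat (n - 2 * ((n - j) div 2))) gchoose ((n - j) div 2))
          * c (n - 2 * ((n - j) div 2))
        = (a gchoose j) * (-2) ^ j * ((a - of_nat j) gchoose ((n - j) div 2)) * c j"
      unfolding eq ..
  qed auto
  also have "\<dots> = (\<Sum>j=0..n div 2. (a gchoose (n - j)) * of_nat ((n - j) choose j)
      * (-2) ^ (n - 2 * j) * c (n - 2 * j))"
  proof (rule sum.cong[OF refl])
    fix j assume "j \<in> {0..n div 2}"
    then have j: "2 * j \<le> n" by auto
    \<comment> \<open>Trinomial revision is used in the opposite direction, to merge the two
      generalized coefficients; symmetry of \<open>(n - j) choose (n - 2 * j)\<close> then yields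
      lower index \<open>j\<close>.\<close>
    have "(a gchoose (n - j)) * of_nat ((n - j) choose (n - 2 * j))
        = (a gchoose (n - 2 * j)) * ((a - of_nat (n - 2 * j)) gchoose (n - j - (n - 2 * j)))"
      using gbinomial_trinomial_revision[of "n - 2 * j" "n - j" a] j
      by (simp add: binomial_gbinomial)
    moreover have "n - j - (n - 2 * j) = j" using j by simp
    moreover have "(n - j) choose (n - 2 * j) = (n - j) choose j"
      using binomial_symmetric[of j "n - j"] j by (simp add: mult_2)
    ultimately have "(a gchoose (n - j)) * of_nat ((n - j) choose j)
        = (a gchoose (n - 2 * j)) * ((a - of_nat (n - 2 * j)) gchoose j)"
      by metis
    then have "(a gchoose (n - j)) * of_nat ((n - j) choose j) * ((-2) ^ (n - 2 * j) * c (n - 2 * j))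
        = (a gchoose (n - 2 * j)) * ((a - of_nat (n - 2 * j)) gchoose j)
          * ((-2) ^ (n - 2 * j) * c (n - 2 * j))"
      by (simp only:)
    then show "(a gchoose (n - 2 * j)) * (-2) ^ (n - 2 * j)
          * ((a - of_nat (n - 2 * j)) gchoose j) * c (n - 2 * j)
        = (a gchoose (n - j)) * of_nat ((n - j) choose j) * (-2) ^ (n - 2 * j) * c (n - 2 * j)"
      by (simp only: mult_ac)
  qed
  finally show "(\<Sum>i=0..n. (a gchoose i) * ((2 * a - 2 * of_nat i) gchoose (n - i)) * (-2) ^ i * d i)
      = (\<Sum>j=0..n div 2. (a gchoose (n - j)) * of_nat ((n - j) choose j)
          * (-2) ^ (n - 2 * j) * c (n - 2 * j))" .
next
  \<comment> \<open>The inner convolution contributes \<open>(-1) ^ (n - j)\<close>; combined with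
    the weight \<open>(-4) ^ j\<close> it leaves a sign independent of \<open>j\<close>, which can
    be pulled out of the sum.\<close>
  have sign: "(-4) ^ j * (-1) ^ (n - j) = (-1) ^ n * (4 :: complex) ^ j" if "j \<le> n" for j
  proof -
    have "(-4 :: complex) ^ j * (-1) ^ (n - j) = ((-1) ^ j * (-1) ^ (n - j)) * 4 ^ j"
      by (simp add: power_minus[of 4])
    also have "(-1 :: complex) ^ j * (-1) ^ (n - j) = (-1) ^ n"
      using that by (simp flip: power_add)
    finally show ?thesis .
  qed
  have "(\<Sum>i=0..n. (a gchoose i) * ((2 * a - 2 * of_nat i) gchoose (n - i)) * (-4) ^ i * d i)
      = (\<Sum>j=0..n. (a gchoose j) * ((-4) ^ j * (-1) ^ (n - j))
          * ((2 * a - 2 * of_nat j) gchoose (n - j)) * c j)"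
    unfolding sum_gchoose_power_binomial_transform[of d c, OF d] sum_gchoose_minus_4
    by (simp add: right_diff_distrib mult.assoc)
  also have "\<dots> = (-1) ^ n * (\<Sum>j=0..n. (a gchoose j)
      * ((2 * a - 2 * of_nat j) gchoose (n - j)) * 4 ^ j * c j)"
    unfolding sum_distrib_left by (intro sum.cong refl) (simp add: sign)
  finally show "(\<Sum>i=0..n. (a gchoose i) * ((2 * a - 2 * of_nat i) gchoose (n - i)) * (-4) ^ i * d i)
      = (-1) ^ n * (\<Sum>j=0..n. (a gchoose j) * ((2 * a - 2 * of_nat j) gchoose (n - j))
          * 4 ^ j * c j)" .
qed

end
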